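(* For every fixed positive integer $k$, there is a polynomial-time algorithm that, given a graph $G$ with $\gamma(G)=k$, decides whether $G$ is well-dominated.
   Context: A graph is well-dominated if all its inclusion-minimal dominating sets have the same size; $\gamma$ is the domination number. *)

theory Defs
  imports "Graph_Theory.Pair_Digraph" "HOL-Computational_Algebra.Polynomial"
begin

section \<open>Domination\<close>

text \<open>
  A finite simple undirected graph is a \<^locale>\<open>pair_graph\<close>: finite, loop-free, and with a
  symmetric set of arcs, each edge being represented by its two orientations.
\<close>

definition dominating_set :: "'a pair_pre_digraph \<Rightarrow> 'a set \<Rightarrow> bool" where
  "dominating_set G D \<longleftrightarrow>
     D \<subseteq> pverts G \<and> (\<forall>v \<in> pverts G - D. \<exists>u \<in> D. (u, v) \<in> parcs G)"

definition minimal_dominating_set :: "'a pair_pre_digraph \<Rightarrow> 'a set \<Rightarrow> bool" where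
  "minimal_dominating_set G D \<longleftrightarrow>
     dominating_set G D \<and> (\<forall>D'. D' \<subset> D \<longrightarrow> \<not> dominating_set G D')"

definition domination_number :: "'a pair_pre_digraph \<Rightarrow> nat" where
  "domination_number G = Min {card D | D. dominating_set G D}"

definition well_dominated :: "'a pair_pre_digraph \<Rightarrow> bool" where
  "well_dominated G \<longleftrightarrow>
     (\<forall>D D'. minimal_dominating_set G D \<and> minimal_dominating_set G D' \<longrightarrow> card D = card D')"

section \<open>Random access machines\<close>

text \<open>
  Algorithms are programs of a random access machine with infinitely many registers holding natural
  numbers and a read-only, randomly accessible input consisting of bits. Every instruction costs one
  time unit. The only arithmetic operations are addition and truncated subtraction, so the
  maximal bit length of the register contents grows by at most one per step, apart from the constants
  of the program; hence unit-cost polynomial time on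
  this machine coincides with polynomial time on Turing machines. (Adding multiplication at unit
  cost would break this.)
\<close>

datatype instr =
    Const nat nat
  | Move nat nat
  | Add nat nat nat
  | Sub nat nat nat
  | Load nat nat
  | Store nat nat
  | Read nat nat
  | Jump nat
  | Jump_zero nat nat

type_synonym program = "instr list"
type_synonym registers = "nat \<Rightarrow> nat"
type_synonym config = "nat \<times> registers"

fun exec_instr :: "instr \<Rightarrow> bool list \<Rightarrow> config \<Rightarrow> config" where
  "exec_instr (Const i c) x (pc, R) = (pc + 1, R(i := c))"
| "exec_instr (Move i j) x (pc, R) = (pc + 1, R(i := R j))"
| "exec_instr (Add i j l) x (pc, R) = (pc + 1, R(i := R j + R l))"
| "exec_instr (Sub i j l) x (pc, R) = (pc + 1, R(i := R j - R l))"
| "exec_instr (Load i j) x (pc, R) = (pc + 1, R(i := R (R j)))"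
| "exec_instr (Store i j) x (pc, R) = (pc + 1, R(R i := R j))"
| "exec_instr (Read i j) x (pc, R) = (pc + 1, R(i := of_bool (R j < length x \<and> x ! R j)))"
| "exec_instr (Jump a) x (pc, R) = (a, R)"
| "exec_instr (Jump_zero i a) x (pc, R) = (if R i = 0 then a else pc + 1, R)"

text \<open>
  A machine halts when the program counter leaves the program; halting configurations are fixed
  points of \<open>step\<close>.
\<close>

definition step :: "program \<Rightarrow> bool list \<Rightarrow> config \<Rightarrow> config" where
  "step P x c = (if fst c < length P then exec_instr (P ! fst c) x c else c)"

definition init_config :: "bool list \<Rightarrow> config" where
  "init_config x = (0, (\<lambda>_. 0)(0 := length x))"

text \<open>
  On input \<open>x\<close>, program \<open>P\<close> halts after at most \<open>t\<close> steps with answer \<open>b\<close>, given as 1 (yes)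
  or 0 (no) in register 0.
\<close>

definition answers_within :: "program \<Rightarrow> bool list \<Rightarrow> nat \<Rightarrow> bool \<Rightarrow> bool" where
  "answers_within P x t b \<longleftrightarrow>
     (\<exists>pc R. (step P x ^^ t) (init_config x) = (pc, R) \<and> length P \<le> pc \<and> R 0 = of_bool b)"

text \<open>
  \<open>P\<close> decides in polynomial time the question \<open>Q\<close> on the instances in \<open>I\<close>, which are presented
  to it through \<open>enc\<close>. This is a promise problem: nothing is required outside \<open>I\<close>.
\<close>

definition poly_time_decides ::
  "program \<Rightarrow> ('i \<Rightarrow> bool list) \<Rightarrow> 'i set \<Rightarrow> ('i \<Rightarrow> bool) \<Rightarrow> bool" where
  "poly_time_decides P enc I Q \<longleftrightarrow>
     (\<exists>p :: nat poly. \<forall>i \<in> I. answers_within P (enc i) (poly p (length (enc i))) (Q i))"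

section \<open>Graphs as inputs\<close>

text \<open>The adjacency matrix, row by row, with respect to the vertex ordering \<open>vs\<close>.\<close>

definition adjacency_bits :: "'a pair_pre_digraph \<Rightarrow> 'a list \<Rightarrow> bool list" where
  "adjacency_bits G vs = concat (map (\<lambda>u. map (\<lambda>v. (u, v) \<in> parcs G) vs) vs)"

definition presented_graphs :: "('a pair_pre_digraph \<times> 'a list) set" where
  "presented_graphs = {(G, vs). pair_graph G \<and> distinct vs \<and> set vs = pverts G}"

end

theory Submission
  imports Defs
begin

text \<open>
  Let \<open>\<gamma>(G) = k\<close>. Then \<open>G\<close> fails to be well-dominated iff it has a minimal dominating set with at
  least \<open>k + 1\<close> elements. Such a set exists iff there are vertices \<open>s\<^sub>0, \<dots>, s\<^sub>k\<close> and
  \<open>p\<^sub>0, \<dots>, p\<^sub>k\<close> such that \<open>s\<^sub>i \<in> N[p\<^sub>j]\<close> holds exactly for \<open>i = j\<close>, and such that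
  the \<open>s\<^sub>i\<close> together with all vertices outside the closed neighbourhoods of the \<open>p\<^sub>j\<close> dominate \<open>G\<close>:
  a minimal dominating subset of the latter set cannot drop any \<open>s\<^sub>i\<close>, because only \<open>s\<^sub>i\<close>
  dominates \<open>p\<^sub>i\<close>; conversely, \<open>k + 1\<close> elements of a minimal dominating set and private neighbours
  of them have this property. For fixed \<open>k\<close> this criterion is a first-order sentence, and a fixed
  first-order formula is evaluated in polynomial time by nested loops over the vertices.
\<close>

section \<open>Large minimal dominating sets\<close>

text \<open>Membership in a closed neighbourhood; with it, domination becomes a single covering
  condition on all vertices.\<close>

definition covers :: "'a pair_pre_digraph \<Rightarrow> 'a \<Rightarrow> 'a \<Rightarrow> bool" where
  "covers G u v \<longleftrightarrow> (u, v) \<in> parcs G \<or> u = v"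

lemma dominating_set_iff_covers:
  "dominating_set G D \<longleftrightarrow> D \<subseteq> pverts G \<and> (\<forall>v \<in> pverts G. \<exists>u \<in> D. covers G u v)"
  unfolding dominating_set_def covers_def by blast

lemma minimal_dominating_subset:
  assumes "finite D" "dominating_set G D"
  obtains D' where "D' \<subseteq> D" "minimal_dominating_set G D'"
proof -
  have "\<exists>D' \<subseteq> D. minimal_dominating_set G D'"
    using assms
  proof (induction D rule: finite_psubset_induct)
    case (psubset D)
    then show ?case
      unfolding minimal_dominating_set_def by (meson order_trans psubset_imp_subset subset_refl)
  qed
  then show ?thesis using that by blast
qed

text \<open>Dropping \<open>s\<close> leaves some vertex uncovered; as \<open>D\<close> itself
  covers that vertex, \<open>s\<close> is the only element of \<open>D\<close> that does.\<close>

lemma private_neighbour: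
  assumes "minimal_dominating_set G D" "s \<in> D"
  shows "\<exists>p \<in> pverts G. \<forall>u \<in> D. covers G u p \<longleftrightarrow> u = s"
proof -
  have "\<not> dominating_set G (D - {s})" "dominating_set G D"
    using assms unfolding minimal_dominating_set_def by blast+
  then obtain p where "p \<in> pverts G" "\<forall>u \<in> D - {s}. \<not> covers G u p"
      and "\<exists>u \<in> D. covers G u p"
    unfolding dominating_set_iff_covers by blast
  then show ?thesis by blast
qed

section \<open>Private systems as certificates for large minimal dominating sets\<close>

definition private_system ::
  "'a pair_pre_digraph \<Rightarrow> nat \<Rightarrow> (nat \<Rightarrow> 'a) \<Rightarrow> (nat \<Rightarrow> 'a) \<Rightarrow> bool" where
  "private_system G m s p \<longleftrightarrow>
     (\<forall>i<m. s i \<in> pverts G) \<and> (\<forall>i<m. p i \<in> pverts G) \<and>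
     (\<forall>i<m. \<forall>j<m. covers G (s i) (p j) \<longleftrightarrow> i = j) \<and>
     (\<forall>v \<in> pverts G. \<exists>u \<in> pverts G. covers G u v \<and>
        ((\<exists>i<m. u = s i) \<or> (\<forall>j<m. \<not> covers G u (p j))))"

lemma large_minimal_dominating_set_iff:
  assumes fin: "finite (pverts G)"
  shows "(\<exists>D. minimal_dominating_set G D \<and> m \<le> card D) \<longleftrightarrow> (\<exists>s p. private_system G m s p)"
proof
  assume "\<exists>D. minimal_dominating_set G D \<and> m \<le> card D"
  then obtain D where D: "minimal_dominating_set G D" "m \<le> card D" by blast
  then have dom: "dominating_set G D" unfolding minimal_dominating_set_def by blast
  then have DV: "D \<subseteq> pverts G" unfolding dominating_set_def by blast
  obtain S where S: "S \<subseteq> D" "card S = m" "finite S"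
    using obtain_subset_with_card_n[OF D(2)] by blast
  then obtain s where s: "bij_betw s {0..<m} S"
    using ex_bij_betw_nat_finite by blast
  have sD: "s i \<in> D" if "i < m" for i
    using s S(1) that bij_betwE by fastforce
  have "\<forall>i. \<exists>q. i < m \<longrightarrow> q \<in> pverts G \<and> (\<forall>u \<in> D. covers G u q \<longleftrightarrow> u = s i)"
    using private_neighbour[OF D(1) sD] by blast
  then obtain p where p: "p i \<in> pverts G" "\<forall>u \<in> D. covers G u (p i) \<longleftrightarrow> u = s i" if "i < m" for i
    by metis
  have inj: "s i = s j \<longleftrightarrow> i = j" if "i < m" "j < m" for i j
    using s that unfolding bij_betw_def inj_on_def by auto
  have "private_system G m s p"
    unfolding private_system_def
  proof (intro conjI)
    show "\<forall>v \<in> pverts G. \<exists>u \<in> pverts G. covers G u v \<and>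
        ((\<exists>i<m. u = s i) \<or> (\<forall>j<m. \<not> covers G u (p j)))"
      \<comment> \<open>An element of \<open>D\<close> different from all \<open>s i\<close> covers
        no \<open>p j\<close>, so every dominator taken from \<open>D\<close> is admissible.\<close>
      using dom p(2) DV unfolding dominating_set_iff_covers by (metis subsetD)
  qed (use p sD DV inj in auto)
  then show "\<exists>s p. private_system G m s p" by blast
next
  assume "\<exists>s p. private_system G m s p"
  then obtain s p where sp: "private_system G m s p" by blast
  define A where "A = s ` {..<m} \<union> {u \<in> pverts G. \<forall>j<m. \<not> covers G u (p j)}"
  have AV: "A \<subseteq> pverts G"
    using sp unfolding A_def private_system_def by auto
  have "\<exists>u \<in> A. covers G u v" if "v \<in> pverts G" for v
  proof -
    obtain u where "u \<in> pverts G" "covers G u v"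
        "(\<exists>i<m. u = s i) \<or> (\<forall>j<m. \<not> covers G u (p j))"
      using sp \<open>v \<in> pverts G\<close> unfolding private_system_def by blast
    then show ?thesis unfolding A_def by blast
  qed
  then have "dominating_set G A"
    using AV unfolding dominating_set_iff_covers by blast
  then obtain D where D: "D \<subseteq> A" "minimal_dominating_set G D"
    using minimal_dominating_subset fin AV finite_subset by metis
  \<comment> \<open>The minimal set \<open>D\<close> must still cover \<open>p i\<close>, and within
    \<open>A\<close> only \<open>s i\<close> does so.\<close>
  have "s i \<in> D" if i: "i < m" for i
  proof -
    have "p i \<in> pverts G"
      using sp i unfolding private_system_def by blast
    then obtain u where u: "u \<in> D" "covers G u (p i)"
      using D(2) unfolding minimal_dominating_set_def dominating_set_iff_covers by blast
    then obtain j where j: "j < m" "u = s j"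
      using D(1) i unfolding A_def by blast
    then have "j = i"
      using sp u(2) i unfolding private_system_def by blast
    with j u show ?thesis by simp
  qed
  then have "s ` {..<m} \<subseteq> D" by blast
  \<comment> \<open>If \<open>s i = s j\<close>, then \<open>s i\<close> covers \<open>p j\<close>,
    which forces \<open>i = j\<close>.\<close>
  moreover have "inj_on s {..<m}"
    using sp unfolding private_system_def inj_on_def by (metis lessThan_iff)
  moreover have "finite D"
    using finite_subset[OF D(1) finite_subset[OF AV fin]] .
  ultimately have "m \<le> card D"
    by (metis card_image card_lessThan card_mono)
  with D show "\<exists>D. minimal_dominating_set G D \<and> m \<le> card D" by blast
qed

text \<open>A smallest dominating set is minimal, so well-domination forces its size on all minimal
  ones. None can be smaller, hence the only obstruction is a minimal one that is larger.\<close>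

lemma well_dominated_iff_no_private_system:
  assumes fin: "finite (pverts G)"
  shows "well_dominated G \<longleftrightarrow> \<not> (\<exists>s p. private_system G (Suc (domination_number G)) s p)"
proof -
  let ?k = "domination_number G" and ?C = "{card D | D. dominating_set G D}"
  have "?C \<subseteq> card ` Pow (pverts G)"
    unfolding dominating_set_def by blast
  then have finC: "finite ?C"
    using fin finite_subset by blast
  have "dominating_set G (pverts G)"
    unfolding dominating_set_def by blast
  then have "?C \<noteq> {}" by blast
  then have "?k \<in> ?C"
    using finC unfolding domination_number_def by (rule Min_in[rotated])
  then obtain D0 where D0: "dominating_set G D0" "card D0 = ?k" by auto
  have finD: "finite D" if "dominating_set G D" for D
    using that fin finite_subset unfolding dominating_set_def by blast
  have ge: "?k \<le> card D" if "dominating_set G D" for D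
    unfolding domination_number_def using that finC by (intro Min_le) auto
  have "minimal_dominating_set G D0"
    unfolding minimal_dominating_set_def
    using D0 ge finD psubset_card_mono by (metis leD)
  then have "well_dominated G \<longleftrightarrow> (\<forall>D. minimal_dominating_set G D \<longrightarrow> card D = ?k)"
    using D0(2) unfolding well_dominated_def by metis
  also have "\<dots> \<longleftrightarrow> \<not> (\<exists>D. minimal_dominating_set G D \<and> Suc ?k \<le> card D)"
    using ge unfolding minimal_dominating_set_def by (metis le_antisym not_less_eq_eq)
  finally show ?thesis
    using large_minimal_dominating_set_iff[OF fin] by simp
qed

section \<open>First-order formulas\<close>

text \<open>Variables are numbers so that they can index registers; few primitives keep the
  compilation to five cases.\<close>

datatype fo = Edge nat nat | Eq nat nat | Neg fo | Conj fo fo | All nat fo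

fun sat :: "'a set \<Rightarrow> ('a \<Rightarrow> 'a \<Rightarrow> bool) \<Rightarrow> (nat \<Rightarrow> 'a) \<Rightarrow> fo \<Rightarrow> bool" where
  "sat A E e (Edge x y) \<longleftrightarrow> E (e x) (e y)"
| "sat A E e (Eq x y) \<longleftrightarrow> e x = e y"
| "sat A E e (Neg f) \<longleftrightarrow> \<not> sat A E e f"
| "sat A E e (Conj f g) \<longleftrightarrow> sat A E e f \<and> sat A E e g"
| "sat A E e (All x f) \<longleftrightarrow> (\<forall>a \<in> A. sat A E (e(x := a)) f)"

text \<open>Truth is invariant under isomorphism. The assignment must take its values in
  \<open>A\<close>, because injectivity of \<open>h\<close> and compatibility with edges are given
  only there.\<close>

lemma sat_bij_betw:
  assumes h: "bij_betw h A B" and E: "\<And>a b. a \<in> A \<Longrightarrow> b \<in> A \<Longrightarrow> E' (h a) (h b) = E a b"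
  shows "(\<forall>x. e x \<in> A) \<Longrightarrow> sat B E' (h \<circ> e) f = sat A E e f"
proof (induction f arbitrary: e)
  case (Eq x y)
  then show ?case using h unfolding bij_betw_def inj_on_def by auto
next
  case (All x f)
  have "sat B E' ((h \<circ> e)(x := h a)) f = sat A E (e(x := a)) f" if "a \<in> A" for a
  proof -
    have "(h \<circ> e)(x := h a) = h \<circ> e(x := a)" by auto
    moreover have "\<forall>y. (e(x := a)) y \<in> A" using All.prems that by simp
    ultimately show ?thesis using All.IH by metis
  qed
  moreover have "sat B E' (h \<circ> e) (All x f) \<longleftrightarrow> (\<forall>a \<in> A. sat B E' ((h \<circ> e)(x := h a)) f)"
    unfolding sat.simps bij_betw_imp_surj_on[OF h, symmetric] by blast
  ultimately show ?case
    unfolding sat.simps by blast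
qed (use E in auto)

section \<open>Derived connectives and blocks of quantifiers\<close>

definition Disj :: "fo \<Rightarrow> fo \<Rightarrow> fo" where
  "Disj f g = Neg (Conj (Neg f) (Neg g))"

definition Exi :: "nat \<Rightarrow> fo \<Rightarrow> fo" where
  "Exi x f = Neg (All x (Neg f))"

definition Conjs :: "fo list \<Rightarrow> fo" where
  "Conjs fs = foldr Conj fs (Eq 0 0)"

definition Exs :: "nat list \<Rightarrow> fo \<Rightarrow> fo" where
  "Exs xs f = foldr Exi xs f"

lemma sat_Disj [simp]: "sat A E e (Disj f g) \<longleftrightarrow> sat A E e f \<or> sat A E e g"
  by (simp add: Disj_def)

lemma sat_Exi [simp]: "sat A E e (Exi x f) \<longleftrightarrow> (\<exists>a \<in> A. sat A E (e(x := a)) f)"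
  by (simp add: Exi_def)

lemma sat_Conjs [simp]: "sat A E e (Conjs fs) \<longleftrightarrow> (\<forall>f \<in> set fs. sat A E e f)"
  by (induction fs) (auto simp: Conjs_def)

lemma sat_Exs:
  "sat A E e (Exs xs f) \<longleftrightarrow>
     (\<exists>e'. (\<forall>x \<in> set xs. e' x \<in> A) \<and> (\<forall>x. x \<notin> set xs \<longrightarrow> e' x = e x) \<and> sat A E e' f)"
proof (induction xs arbitrary: e)
  case Nil
  have "e' = e" if "\<forall>x. e' x = e x" for e'
    using that by blast
  then show ?case by (auto simp: Exs_def)
next
  case (Cons y xs)
  \<comment> \<open>If \<open>y\<close> recurs in \<open>xs\<close>, its first value is overwritten
    later; any element of \<open>A\<close> can stand for that value, and \<open>e' y\<close> always
    serves.\<close>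
  have upd: "(\<exists>a \<in> A. (\<forall>x \<in> set xs. e' x \<in> A) \<and> (\<forall>x. x \<notin> set xs \<longrightarrow> e' x = (e(y := a)) x))
      \<longleftrightarrow> (\<forall>x \<in> set (y # xs). e' x \<in> A) \<and> (\<forall>x. x \<notin> set (y # xs) \<longrightarrow> e' x = e x)"
    (is "?L \<longleftrightarrow> ?R") for e'
  proof
    assume ?L
    then show ?R by (cases "y \<in> set xs") auto
  next
    assume ?R
    then show ?L by (intro bexI[of _ "e' y"]) auto
  qed
  have "Exs (y # xs) f = Exi y (Exs xs f)"
    by (simp add: Exs_def)
  then have "sat A E e (Exs (y # xs) f) \<longleftrightarrow> (\<exists>e'. (\<exists>a \<in> A. (\<forall>x \<in> set xs. e' x \<in> A) \<and>
      (\<forall>x. x \<notin> set xs \<longrightarrow> e' x = (e(y := a)) x)) \<and> sat A E e' f)"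
    unfolding sat_Exi Cons.IH by (simp only: sat_Exi Cons.IH) blast
  then show ?case
    unfolding upd by blast
qed

section \<open>The criterion as a first-order sentence\<close>

definition Covers :: "nat \<Rightarrow> nat \<Rightarrow> fo" where
  "Covers x y = Disj (Edge x y) (Eq x y)"

text \<open>The variables \<open>i < m\<close> stand for the \<open>s\<^sub>i\<close>, the variables \<open>m + i\<close> for the \<open>p\<^sub>i\<close>.\<close>

definition private_matrix :: "nat \<Rightarrow> fo" where
  "private_matrix m = Conj
     (Conjs [if i = j then Covers i (m + j) else Neg (Covers i (m + j)).
        i \<leftarrow> [0..<m], j \<leftarrow> [0..<m]])
     (All (2 * m) (Exi (2 * m + 1) (Conj (Covers (2 * m + 1) (2 * m))
        (Disj (Neg (Conjs [Neg (Eq (2 * m + 1) i). i \<leftarrow> [0..<m]]))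
              (Conjs [Neg (Covers (2 * m + 1) (m + j)). j \<leftarrow> [0..<m]])))))"

definition private_sentence :: "nat \<Rightarrow> fo" where
  "private_sentence m = Exs [0..<2 * m] (private_matrix m)"

text \<open>The hypothesis supplies the membership conjuncts of \<open>private_system\<close>, which
  the formula does not state; in the sentence they come from the range of the quantifiers.\<close>

lemma sat_private_matrix:
  assumes "\<forall>x<2 * m. e x \<in> pverts G"
  shows "sat (pverts G) (\<lambda>u v. (u, v) \<in> parcs G) e (private_matrix m) \<longleftrightarrow>
    private_system G m e (\<lambda>i. e (m + i))"
proof -
  have dom: "sat A (\<lambda>u v. (u, v) \<in> parcs G) e' (Covers x y) \<longleftrightarrow> covers G (e' x) (e' y)"
    for A e' x y
    by (simp add: Covers_def covers_def)
  have priv: "sat (pverts G) (\<lambda>u v. (u, v) \<in> parcs G) e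
        (Conjs [if i = j then Covers i (m + j) else Neg (Covers i (m + j)).
          i \<leftarrow> [0..<m], j \<leftarrow> [0..<m]]) \<longleftrightarrow>
      (\<forall>i \<in> {0..<m}. \<forall>j \<in> {0..<m}. covers G (e i) (e (m + j)) \<longleftrightarrow> i = j)"
    by (simp add: dom) auto
  have "sat (pverts G) (\<lambda>u v. (u, v) \<in> parcs G) (e(2 * m := v, 2 * m + 1 := u))
        (Conj (Covers (2 * m + 1) (2 * m))
        (Disj (Neg (Conjs [Neg (Eq (2 * m + 1) i). i \<leftarrow> [0..<m]]))
              (Conjs [Neg (Covers (2 * m + 1) (m + j)). j \<leftarrow> [0..<m]]))) \<longleftrightarrow>
      covers G u v \<and> ((\<exists>i<m. u = e i) \<or> (\<forall>j<m. \<not> covers G u (e (m + j))))" for u v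
  proof -
    \<comment> \<open>The bound variables \<open>2 * m\<close> and \<open>2 * m + 1\<close> lie
      above those of the two tuples, so binding them leaves the tuples unchanged.\<close>
    define e' where "e' = e(2 * m := v, 2 * m + 1 := u)"
    have e': "e' (2 * m) = v" "e' (2 * m + 1) = u" "\<And>i. i < 2 * m \<Longrightarrow> e' i = e i"
      unfolding e'_def by auto
    have "(\<exists>i<m. u = e' i) \<longleftrightarrow> (\<exists>i<m. u = e i)"
      "(\<forall>j<m. \<not> covers G u (e' (m + j))) \<longleftrightarrow> (\<forall>j<m. \<not> covers G u (e (m + j)))"
      using e'(3) by auto
    then show ?thesis
      unfolding e'_def[symmetric] sat.simps sat_Disj sat_Conjs dom e'(1)
      using e'(2) by (auto simp: dom)
  qed
  then have domination: "sat (pverts G) (\<lambda>u v. (u, v) \<in> parcs G) e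
        (All (2 * m) (Exi (2 * m + 1) (Conj (Covers (2 * m + 1) (2 * m))
        (Disj (Neg (Conjs [Neg (Eq (2 * m + 1) i). i \<leftarrow> [0..<m]]))
              (Conjs [Neg (Covers (2 * m + 1) (m + j)). j \<leftarrow> [0..<m]]))))) \<longleftrightarrow>
      (\<forall>v \<in> pverts G. \<exists>u \<in> pverts G. covers G u v \<and>
        ((\<exists>i<m. u = e i) \<or> (\<forall>j<m. \<not> covers G u (e (m + j)))))"
    by (simp only: sat.simps(5) sat_Exi)
  have "(\<forall>i<m. e i \<in> pverts G) \<and> (\<forall>i<m. e (m + i) \<in> pverts G)"
    using assms by simp
  then show ?thesis
    unfolding private_matrix_def private_system_def sat.simps(4) priv domination by auto
qed

lemma sat_private_sentence:
  "sat (pverts G) (\<lambda>u v. (u, v) \<in> parcs G) e (private_sentence m) \<longleftrightarrow>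
     (\<exists>s p. private_system G m s p)"
proof
  assume "sat (pverts G) (\<lambda>u v. (u, v) \<in> parcs G) e (private_sentence m)"
  then show "\<exists>s p. private_system G m s p"
    unfolding private_sentence_def sat_Exs using sat_private_matrix by fastforce
next
  assume "\<exists>s p. private_system G m s p"
  then obtain s p where sp: "private_system G m s p" by blast
  \<comment> \<open>The two tuples are laid side by side; from \<open>2 * m\<close> on the
    assignment must agree with \<open>e\<close>, as \<open>sat_Exs\<close> demands.\<close>
  define e' where "e' x = (if x < m then s x else if x < 2 * m then p (x - m) else e x)" for x
  have V: "\<forall>x<2 * m. e' x \<in> pverts G"
    using sp unfolding private_system_def e'_def by auto
  have "private_system G m e' (\<lambda>i. e' (m + i)) \<longleftrightarrow> private_system G m s p"
    unfolding private_system_def e'_def by (simp cong: conj_cong)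
  then show "sat (pverts G) (\<lambda>u v. (u, v) \<in> parcs G) e (private_sentence m)"
    unfolding private_sentence_def sat_Exs
    using sp sat_private_matrix[OF V] V by (intro exI[of _ e'] conjI) (simp_all, simp add: e'_def)
qed

section \<open>Running programs\<close>

text \<open>The time is only an upper bound, so that branches of different lengths can share one
  bound.\<close>

definition runs :: "program \<Rightarrow> bool list \<Rightarrow> config \<Rightarrow> nat \<Rightarrow> config \<Rightarrow> bool" where
  "runs P w c t c' \<longleftrightarrow> (\<exists>t'\<le>t. (step P w ^^ t') c = c')"

lemma runs_eq: "c = c' \<Longrightarrow> runs P w c 0 c'"
  by (simp add: runs_def)

lemma runs_trans:
  assumes "runs P w c t c'" "runs P w c' u c''"
  shows "runs P w c (t + u) c''"
proof -
  obtain t' u' where "t' \<le> t" "(step P w ^^ t') c = c'" "u' \<le> u" "(step P w ^^ u') c' = c''"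
    using assms unfolding runs_def by blast
  then have "(step P w ^^ (u' + t')) c = c''" "u' + t' \<le> t + u"
    by (auto simp: funpow_add)
  then show ?thesis unfolding runs_def by blast
qed

lemma runs_mono: "runs P w c t c' \<Longrightarrow> t \<le> u \<Longrightarrow> runs P w c u c'"
  unfolding runs_def using le_trans by blast

text \<open>Symbolic execution: repeated use, ended by \<open>runs_eq\<close>, follows the code
  instruction by instruction.\<close>

lemma runs_step:
  assumes "pc < length P" "runs P w (exec_instr (P ! pc) w (pc, R)) t c'"
  shows "runs P w (pc, R) (Suc t) c'"
proof -
  have "runs P w (pc, R) 1 (exec_instr (P ! pc) w (pc, R))"
    unfolding runs_def using assms(1) by (intro exI[of _ 1]) (simp add: step_def)
  from runs_trans[OF this assms(2)] show ?thesis by simp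
qed

text \<open>Halting configurations are fixed points, so an upper bound on the time yields the exact
  step count that \<open>answers_within\<close> uses.\<close>

lemma runs_halt:
  assumes "runs P w c t (pc, R)" "length P \<le> pc"
  shows "(step P w ^^ t) c = (pc, R)"
proof -
  obtain t' where t': "t' \<le> t" "(step P w ^^ t') c = (pc, R)"
    using assms(1) unfolding runs_def by blast
  have "(step P w ^^ d) (pc, R) = (pc, R)" for d
    using assms(2) by (induction d) (auto simp: step_def)
  then have "(step P w ^^ (t - t' + t')) c = (pc, R)"
    unfolding funpow_add using t'(2) by simp
  then show ?thesis using t'(1) by simp
qed

definition code_at :: "program \<Rightarrow> nat \<Rightarrow> program \<Rightarrow> bool" where
  "code_at P a c \<longleftrightarrow> (\<forall>i<length c. a + i < length P \<and> P ! (a + i) = c ! i)"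

lemma code_at_Nil [simp]: "code_at P a []"
  by (simp add: code_at_def)

lemma code_at_Cons [simp]:
  "code_at P a (i # c) \<longleftrightarrow> a < length P \<and> P ! a = i \<and> code_at P (Suc a) c"
  unfolding code_at_def by (auto simp: All_less_Suc2)

lemma code_at_append [simp]:
  "code_at P a (c @ d) \<longleftrightarrow> code_at P a c \<and> code_at P (a + length c) d"
  by (induction c arbitrary: a) auto

section \<open>Evaluating first-order formulas on the machine\<close>

text \<open>
  Registers 1 and 2 hold 1 and the number \<open>n\<close> of vertices; 0, 3 and 4 are scratch, and truth values
  are returned in 0. A variable is stored together with its \<open>n\<close>-fold multiple, so that positions in
  the adjacency matrix can be computed without multiplication. A quantifier at nesting depth \<open>d\<close> saves
  the value of the variable it binds in the registers for \<open>d\<close>, so that evaluation leaves all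
  variables intact.
\<close>

abbreviation (input) var_reg :: "nat \<Rightarrow> nat" where "var_reg x \<equiv> 4 * x + 5"
abbreviation (input) row_reg :: "nat \<Rightarrow> nat" where "row_reg x \<equiv> 4 * x + 6"
abbreviation (input) save_var_reg :: "nat \<Rightarrow> nat" where "save_var_reg d \<equiv> 4 * d + 7"
abbreviation (input) save_row_reg :: "nat \<Rightarrow> nat" where "save_row_reg d \<equiv> 4 * d + 8"

text \<open>The four register families lie in the four different residue classes modulo 4.\<close>

lemma reg_distinct [simp]:
  "var_reg x \<noteq> row_reg y" "var_reg x \<noteq> save_var_reg y" "var_reg x \<noteq> save_row_reg y"
  "row_reg x \<noteq> var_reg y" "row_reg x \<noteq> save_var_reg y" "row_reg x \<noteq> save_row_reg y"
  "save_var_reg x \<noteq> var_reg y" "save_var_reg x \<noteq> row_reg y" "save_var_reg x \<noteq> save_row_reg y"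
  "save_row_reg x \<noteq> var_reg y" "save_row_reg x \<noteq> row_reg y" "save_row_reg x \<noteq> save_var_reg y"
  by presburger+

text \<open>Jump targets need code lengths before the code is generated; these depend neither on the
  address nor on the depth.\<close>

fun fo_size :: "fo \<Rightarrow> nat" where
  "fo_size (Edge x y) = 2"
| "fo_size (Eq x y) = 4"
| "fo_size (Neg f) = fo_size f + 1"
| "fo_size (Conj f g) = fo_size f + fo_size g + 1"
| "fo_size (All x f) = fo_size f + 13"

text \<open>Here \<open>a\<close> is the absolute start address. A conjunction skips its second half
  once the first is false, and a quantifier loop exits at the first counterexample; at
  \<open>a + fo_size f + 11\<close> the bound variable is restored.\<close>

fun fo_code :: "nat \<Rightarrow> nat \<Rightarrow> fo \<Rightarrow> program" where
  "fo_code a d (Edge x y) = [Add 3 (row_reg x) (var_reg y), Read 0 3]"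
| "fo_code a d (Eq x y) =
    [Sub 3 (var_reg x) (var_reg y), Sub 4 (var_reg y) (var_reg x), Add 3 3 4, Sub 0 1 3]"
| "fo_code a d (Neg f) = fo_code a d f @ [Sub 0 1 0]"
| "fo_code a d (Conj f g) =
    fo_code a d f @
    [Jump_zero 0 (a + fo_size f + fo_size g + 1)] @
    fo_code (a + fo_size f + 1) d g"
| "fo_code a d (All x f) =
    [Move (save_var_reg d) (var_reg x), Move (save_row_reg d) (row_reg x),
     Const (var_reg x) 0, Const (row_reg x) 0, Const 0 1,
     Sub 3 2 (var_reg x), Jump_zero 3 (a + fo_size f + 11)] @
    fo_code (a + 7) (Suc d) f @
    [Jump_zero 0 (a + fo_size f + 11),
     Add (var_reg x) (var_reg x) 1, Add (row_reg x) (row_reg x) 2, Jump (a + 5),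
     Move (var_reg x) (save_var_reg d), Move (row_reg x) (save_row_reg d)]"

text \<open>A quantifier multiplies the cost by \<open>n\<close>: each round adds 6 instructions to
  the body, while setup, last test and restoring take 5 + 2 + 2. The degree is thus at most the
  nesting depth of quantifiers.\<close>

fun fo_time :: "fo \<Rightarrow> nat poly" where
  "fo_time (Edge x y) = [:2:]"
| "fo_time (Eq x y) = [:4:]"
| "fo_time (Neg f) = fo_time f + [:1:]"
| "fo_time (Conj f g) = fo_time f + fo_time g + [:1:]"
| "fo_time (All x f) = [:0, 1:] * (fo_time f + [:6:]) + [:9:]"

lemma length_fo_code [simp]: "length (fo_code a d f) = fo_size f"
  by (induction f arbitrary: a d) auto

section \<open>Register invariants\<close>

definition holds_env :: "nat \<Rightarrow> (nat \<Rightarrow> nat) \<Rightarrow> registers \<Rightarrow> bool" where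
  "holds_env n e R \<longleftrightarrow>
     R 1 = 1 \<and> R 2 = n \<and> (\<forall>x. R (var_reg x) = e x \<and> R (row_reg x) = e x * n)"

text \<open>Code at depth \<open>d\<close> may overwrite the save registers of depth
  \<open>d\<close> and beyond, but not those of the enclosing quantifiers.\<close>

definition scratch :: "nat \<Rightarrow> nat set" where
  "scratch d = {0, 3, 4} \<union> save_var_reg ` {d..} \<union> save_row_reg ` {d..}"

definition same_except :: "nat set \<Rightarrow> registers \<Rightarrow> registers \<Rightarrow> bool" where
  "same_except A R R' \<longleftrightarrow> (\<forall>r. r \<notin> A \<longrightarrow> R' r = R r)"

lemma same_except_trans:
  "same_except A R R' \<Longrightarrow> same_except A R' R'' \<Longrightarrow> same_except A R R''"
  by (simp add: same_except_def)

lemma same_except_mono: "same_except A R R' \<Longrightarrow> A \<subseteq> B \<Longrightarrow> same_except B R R'"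
  unfolding same_except_def by blast

lemma same_except_upd: "r \<in> A \<Longrightarrow> same_except A R R' \<Longrightarrow> same_except A R (R'(r := v))"
  by (simp add: same_except_def)

lemma scratch_simps [simp]:
  "0 \<in> scratch d" "1 \<notin> scratch d" "Suc 0 \<notin> scratch d" "2 \<notin> scratch d" "3 \<in> scratch d" "4 \<in> scratch d"
  "var_reg x \<notin> scratch d" "row_reg x \<notin> scratch d"
  "save_var_reg e \<in> scratch d \<longleftrightarrow> d \<le> e" "save_row_reg e \<in> scratch d \<longleftrightarrow> d \<le> e"
  unfolding scratch_def image_def by (auto; presburger)+

lemma scratch_Suc_subset: "scratch (Suc d) \<subseteq> scratch d"
  unfolding scratch_def by auto

lemma holds_env_same_except:
  "same_except (scratch d) R R' \<Longrightarrow> holds_env n e R \<Longrightarrow> holds_env n e R'"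
  unfolding holds_env_def same_except_def by simp

lemma holds_env_upd:
  assumes "holds_env n e R"
    and "R' (var_reg x) = v" "R' (row_reg x) = v * n"
    and "same_except (scratch d \<union> {var_reg x, row_reg x}) R R'"
  shows "holds_env n (e(x := v)) R'"
proof -
  have "R' r = R r" if "r \<notin> scratch d" "r \<noteq> var_reg x" "r \<noteq> row_reg x" for r
    using assms(4) that unfolding same_except_def by blast
  moreover have "var_reg y \<noteq> row_reg x" "row_reg y \<noteq> var_reg x" for y
    by presburger+
  ultimately show ?thesis
    using assms(1-3) unfolding holds_env_def by simp
qed

text \<open>Induction on the number of values still to be tested. Register 0 holds 1 whenever the
  test is reached, since no counterexample has been found so far; this is the right answer once the
  range is exhausted.\<close>

lemma quantifier_loop:
  assumes code: "code_at P a ([Sub 3 2 (var_reg x), Jump_zero 3 (a + l + 6)] @ c @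
      [Jump_zero 0 (a + l + 6), Add (var_reg x) (var_reg x) 1, Add (row_reg x) (row_reg x) 2, Jump a])"
    and len: "length c = l"
    and body: "\<And>v R. holds_env n (e(x := v)) R \<Longrightarrow>
      \<exists>R'. runs P w (a + 2, R) t (a + 2 + l, R') \<and> same_except (scratch d) R R' \<and> R' 0 = of_bool (Q v)"
  shows "holds_env n (e(x := v)) R \<Longrightarrow> R 0 = 1 \<Longrightarrow> v \<le> n \<Longrightarrow>
    \<exists>R'. runs P w (a, R) ((n - v) * (t + 6) + 2) (a + l + 6, R') \<and>
      same_except (scratch d \<union> {var_reg x, row_reg x}) R R' \<and> R' 0 = of_bool (\<forall>u\<in>{v..<n}. Q u)"
proof (induction "n - v" arbitrary: v R)
  case 0
  let ?R = "R(3 := 0)"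
  have "R 2 = n" "R (var_reg x) = v" "v = n"
    using 0 unfolding holds_env_def by auto
  then have "runs P w (a, R) ((n - v) * (t + 6) + 2) (a + l + 6, ?R)"
    using code by (auto intro!: runs_step runs_eq simp: numeral_2_eq_2)
  moreover have "same_except (scratch d \<union> {var_reg x, row_reg x}) R ?R"
    by (simp add: same_except_def)
  moreover have "?R 0 = of_bool (\<forall>u\<in>{v..<n}. Q u)"
    using \<open>v = n\<close> 0 by simp
  ultimately show ?case by blast
next
  case (Suc k)
  let ?A = "scratch d \<union> {var_reg x, row_reg x}"
  let ?R1 = "R(3 := n - v)"
  have R: "R 2 = n" "R (var_reg x) = v" "v < n"
    using Suc unfolding holds_env_def by auto
  then have run1: "runs P w (a, R) 2 (a + 2, ?R1)"
    using code by (auto intro!: runs_step runs_eq simp: numeral_2_eq_2)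
  have s1: "same_except ?A R ?R1" and s1': "same_except (scratch d) R ?R1"
    by (simp_all add: same_except_def)
  have env1: "holds_env n (e(x := v)) ?R1"
    using holds_env_same_except[OF s1'] Suc.prems(1) .
  obtain R2 where run2: "runs P w (a + 2, ?R1) t (a + 2 + l, R2)"
    and s2': "same_except (scratch d) ?R1 R2" and R2: "R2 0 = of_bool (Q v)"
    using body[OF env1] by blast
  have run12: "runs P w (a, R) (t + 2) (a + 2 + l, R2)"
    using runs_trans[OF run1 run2] by (simp add: add.commute)
  have s2: "same_except ?A R R2"
    using same_except_trans[OF s1 same_except_mono[OF s2']] by blast
  have env2: "holds_env n (e(x := v)) R2"
    using holds_env_same_except[OF s2' env1] .
  \<comment> \<open>Two steps for the test, at most \<open>t\<close> for the body, four to advance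
    and jump back.\<close>
  have time: "(n - v) * (t + 6) + 2 = (t + 2) + (4 + ((n - Suc v) * (t + 6) + 2))"
    using R(3) by (simp add: Suc_diff_Suc[symmetric])
  show ?case
  proof (cases "Q v")
    case False
    have "runs P w (a + 2 + l, R2) (Suc 0) (a + l + 6, R2)"
      using code len R2 False by (auto intro!: runs_step runs_eq simp: algebra_simps)
    \<comment> \<open>An early exit takes a single step; the bound is padded to that of the full
      loop.\<close>
    then have "runs P w (a + 2 + l, R2) (4 + ((n - Suc v) * (t + 6) + 2)) (a + l + 6, R2)"
      by (rule runs_mono) simp
    then have "runs P w (a, R) ((n - v) * (t + 6) + 2) (a + l + 6, R2)"
      unfolding time by (rule runs_trans[OF run12])
    then show ?thesis
      using s2 R2 False R(3) by (intro exI[of _ R2]) auto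
  next
    case True
    let ?R3 = "R2(var_reg x := Suc v, row_reg x := Suc v * n)"
    have v2: "R2 (var_reg x) = v" "R2 (row_reg x) = v * n" "R2 1 = 1" "R2 2 = n"
      using env2 unfolding holds_env_def by auto
    have s3': "same_except ?A R2 ?R3"
      by (simp add: same_except_def)
    have env3: "holds_env n (e(x := Suc v)) ?R3"
      using holds_env_upd[OF env2 _ _ s3', of "Suc v"] by simp
    have run3: "runs P w (a + 2 + l, R2) 4 (a, ?R3)"
    proof -
      have "runs P w (a + 2 + l, R2) (Suc (Suc (Suc (Suc 0)))) (a, ?R3)"
        using code len R2 True v2
        by (auto intro!: runs_step runs_eq simp: algebra_simps)
      then show ?thesis by (simp add: eval_nat_numeral)
    qed
    have k: "k = n - Suc v"
      using Suc.hyps(2) by simp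
    obtain R4 where run4: "runs P w (a, ?R3) ((n - Suc v) * (t + 6) + 2) (a + l + 6, R4)"
      and s4: "same_except ?A ?R3 R4" and R4: "R4 0 = of_bool (\<forall>u\<in>{Suc v..<n}. Q u)"
      using Suc.hyps(1)[OF k env3] R2 True R(3) by auto
    have "runs P w (a, R) ((n - v) * (t + 6) + 2) (a + l + 6, R4)"
      unfolding time by (rule runs_trans[OF run12 runs_trans[OF run3 run4]])
    moreover have "same_except ?A R R4"
      using same_except_trans[OF s2 same_except_trans[OF s3' s4]] .
    moreover have "{v..<n} = insert v {Suc v..<n}"
      using R(3) by auto
    then have "R4 0 = of_bool (\<forall>u\<in>{v..<n}. Q u)"
      using R4 True by simp
    ultimately show ?thesis by blast
  qed
qed

text \<open>Subformulas sit at other addresses and depths and are evaluated under other assignments,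
  so the induction generalises over all of these. Preserving every register outside
  \<open>scratch d\<close> keeps the variables valid from one subformula to the next.\<close>

lemma fo_code_correct:
  assumes E: "\<And>i j. E i j \<longleftrightarrow> i * n + j < length w \<and> w ! (i * n + j)"
  shows "code_at P a (fo_code a d f) \<Longrightarrow> holds_env n e R \<Longrightarrow>
    \<exists>R'. runs P w (a, R) (poly (fo_time f) n) (a + fo_size f, R') \<and>
      same_except (scratch d) R R' \<and> R' 0 = of_bool (sat {..<n} E e f)"
proof (induction f arbitrary: a d e R)
  case (Edge x y)
  let ?R = "R(3 := e x * n + e y, 0 := of_bool (E (e x) (e y)))"
  have R: "R (var_reg y) = e y" "R (row_reg x) = e x * n"
    using Edge.prems unfolding holds_env_def by auto
  have "runs P w (a, R) (Suc (Suc 0)) (a + 2, ?R)"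
    using Edge.prems(1) R E by (auto intro!: runs_step runs_eq)
  then have "runs P w (a, R) (poly (fo_time (Edge x y)) n) (a + fo_size (Edge x y), ?R)"
    by (simp add: numeral_2_eq_2)
  moreover have "same_except (scratch d) R ?R"
    by (simp add: same_except_def)
  moreover have "?R 0 = of_bool (sat {..<n} E e (Edge x y))"
    by simp
  ultimately show ?case by blast
next
  case (Eq x y)
  \<comment> \<open>The two truncated differences add up to the distance of the values, so
    subtracting the sum from 1 gives the truth value of equality.\<close>
  let ?R = "R(3 := e x - e y + (e y - e x), 4 := e y - e x, 0 := of_bool (e x = e y))"
  have R: "R (var_reg x) = e x" "R (var_reg y) = e y" "R 1 = 1"
    using Eq.prems unfolding holds_env_def by auto
  have "runs P w (a, R) (Suc (Suc (Suc (Suc 0)))) (a + 4, ?R)"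
    using Eq.prems(1) R by (auto intro!: runs_step runs_eq simp: fun_eq_iff)
  then have "runs P w (a, R) (poly (fo_time (Eq x y)) n) (a + fo_size (Eq x y), ?R)"
    by (simp add: eval_nat_numeral)
  moreover have "same_except (scratch d) R ?R"
    by (simp add: same_except_def)
  moreover have "?R 0 = of_bool (sat {..<n} E e (Eq x y))"
    by simp
  ultimately show ?case by blast
next
  case (Neg f)
  obtain R1 where run: "runs P w (a, R) (poly (fo_time f) n) (a + fo_size f, R1)"
    and s: "same_except (scratch d) R R1" and R1: "R1 0 = of_bool (sat {..<n} E e f)"
    using Neg.IH[of a d e R] Neg.prems by auto
  let ?R = "R1(0 := of_bool (\<not> sat {..<n} E e f))"
  have "R1 1 = 1"
    using holds_env_same_except[OF s] Neg.prems(2) unfolding holds_env_def by blast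
  then have "runs P w (a + fo_size f, R1) (Suc 0) (a + fo_size f + 1, ?R)"
    using Neg.prems(1) R1 by (auto intro!: runs_step runs_eq simp: of_bool_def)
  from runs_trans[OF run this]
  have "runs P w (a, R) (poly (fo_time (Neg f)) n) (a + fo_size (Neg f), ?R)"
    by simp
  moreover have "same_except (scratch d) R ?R"
    using s by (simp add: same_except_upd)
  moreover have "?R 0 = of_bool (sat {..<n} E e (Neg f))"
    by simp
  ultimately show ?case by blast
next
  case (Conj f g)
  obtain R1 where run: "runs P w (a, R) (poly (fo_time f) n) (a + fo_size f, R1)"
    and s: "same_except (scratch d) R R1" and R1: "R1 0 = of_bool (sat {..<n} E e f)"
    using Conj.IH(1)[of a d e R] Conj.prems by auto
  have env1: "holds_env n e R1"
    using holds_env_same_except[OF s Conj.prems(2)] .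
  show ?case
  proof (cases "sat {..<n} E e f")
    case False
    have "runs P w (a + fo_size f, R1) (Suc 0) (a + fo_size f + fo_size g + 1, R1)"
      using Conj.prems(1) R1 False by (auto intro!: runs_step runs_eq)
    then have "runs P w (a + fo_size f, R1) (Suc (poly (fo_time g) n)) (a + fo_size f + fo_size g + 1, R1)"
      by (rule runs_mono) simp
    from runs_trans[OF run this] show ?thesis
      using s R1 False by (intro exI[of _ R1]) (simp add: algebra_simps)
  next
    case True
    obtain R2 where run2: "runs P w (a + fo_size f + 1, R1) (poly (fo_time g) n)
          (a + fo_size f + 1 + fo_size g, R2)"
      and s2: "same_except (scratch d) R1 R2" and R2: "R2 0 = of_bool (sat {..<n} E e g)"
      using Conj.IH(2)[of "a + fo_size f + 1" d e R1] Conj.prems env1 by auto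
    have "runs P w (a + fo_size f, R1) (Suc (poly (fo_time g) n)) (a + fo_size f + 1 + fo_size g, R2)"
      using Conj.prems(1) R1 True run2 by (auto intro!: runs_step)
    from runs_trans[OF run this] show ?thesis
      using same_except_trans[OF s s2] R2 True by (intro exI[of _ R2]) (simp add: algebra_simps)
  qed
next
  case (All x f)
  define t where "t = poly (fo_time f) n"
  \<comment> \<open>The body runs at depth \<open>Suc d\<close>, so the save registers of depth
    \<open>d\<close> are outside \<open>?A\<close> and survive the loop.\<close>
  let ?A = "scratch (Suc d) \<union> {var_reg x, row_reg x}"
  let ?Q = "\<lambda>v. sat {..<n} E (e(x := v)) f"
  let ?R1 = "R(save_var_reg d := e x, save_row_reg d := e x * n,
    var_reg x := 0, row_reg x := 0, 0 := 1)"
  have R: "R (var_reg x) = e x" "R (row_reg x) = e x * n"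
    using All.prems unfolding holds_env_def by auto
  have run1: "runs P w (a, R) 5 (a + 5, ?R1)"
  proof -
    have "runs P w (a, R) (Suc (Suc (Suc (Suc (Suc 0))))) (a + 5, ?R1)"
      using All.prems(1) R by (auto intro!: runs_step runs_eq)
    then show ?thesis by (simp add: eval_nat_numeral)
  qed
  have env1: "holds_env n (e(x := 0)) ?R1"
  proof (rule holds_env_upd[OF All.prems(2)])
    show "same_except (scratch d \<union> {var_reg x, row_reg x}) R ?R1"
      by (simp add: same_except_def)
  qed simp_all
  have body: "\<exists>R'. runs P w (a + 5 + 2, R) t (a + 5 + 2 + fo_size f, R') \<and>
      same_except (scratch (Suc d)) R R' \<and> R' 0 = of_bool (?Q v)"
    if "holds_env n (e(x := v)) R" for v R
  proof -
    have "code_at P (a + 7) (fo_code (a + 7) (Suc d) f)"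
      using All.prems(1) by (simp add: eval_nat_numeral)
    moreover have "a + 5 + 2 = a + 7" by simp
    ultimately show ?thesis
      using All.IH that unfolding t_def by presburger
  qed
  have "code_at P (a + 5) ([Sub 3 2 (var_reg x), Jump_zero 3 (a + 5 + fo_size f + 6)] @
      fo_code (a + 7) (Suc d) f @ [Jump_zero 0 (a + 5 + fo_size f + 6),
      Add (var_reg x) (var_reg x) 1, Add (row_reg x) (row_reg x) 2, Jump (a + 5)])"
    using All.prems(1) by (simp add: algebra_simps eval_nat_numeral)
  from quantifier_loop[where Q = ?Q, OF this length_fo_code body env1] obtain R2 where
    run2: "runs P w (a + 5, ?R1) (n * (t + 6) + 2) (a + 5 + fo_size f + 6, R2)"
    and s2: "same_except ?A ?R1 R2" and R2: "R2 0 = of_bool (\<forall>v\<in>{0..<n}. ?Q v)"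
    by auto
  let ?R3 = "R2(var_reg x := e x, row_reg x := e x * n)"
  have saved: "R2 (save_var_reg d) = e x" "R2 (save_row_reg d) = e x * n"
  proof -
    have "save_var_reg d \<notin> ?A" "save_row_reg d \<notin> ?A"
      by simp_all
    then show "R2 (save_var_reg d) = e x" "R2 (save_row_reg d) = e x * n"
      using s2 unfolding same_except_def by simp_all
  qed
  have run3: "runs P w (a + 5 + fo_size f + 6, R2) 2 (a + fo_size (All x f), ?R3)"
  proof -
    have "code_at P (a + 5 + fo_size f + 6)
        [Move (var_reg x) (save_var_reg d), Move (row_reg x) (save_row_reg d)]"
      using All.prems(1) by (simp add: eval_nat_numeral)
    then have "runs P w (a + 5 + fo_size f + 6, R2) (Suc (Suc 0)) (a + fo_size (All x f), ?R3)"
      using saved by (auto intro!: runs_step runs_eq)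
    then show ?thesis by (simp add: eval_nat_numeral)
  qed
  have "runs P w (a, R) (5 + (n * (t + 6) + 2 + 2)) (a + fo_size (All x f), ?R3)"
    by (rule runs_trans[OF run1 runs_trans[OF run2 run3]])
  moreover have "5 + (n * (t + 6) + 2 + 2) = poly (fo_time (All x f)) n"
    by (simp add: t_def)
  moreover have "same_except (scratch d) R ?R3"
    unfolding same_except_def
  proof (intro allI impI)
    fix r assume r: "r \<notin> scratch d"
    then have "r \<notin> scratch (Suc d)" "r \<noteq> save_var_reg d" "r \<noteq> save_row_reg d"
      using scratch_Suc_subset[of d] by auto
    moreover have "r \<noteq> 0"
      using r scratch_simps(1) by metis
    ultimately show "?R3 r = R r"
      using s2 R unfolding same_except_def by auto
  qed
  moreover have "?R3 0 = of_bool (sat {..<n} E e (All x f))"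
    using R2 by (simp add: atLeast0LessThan)
  ultimately show ?case by metis
qed

text \<open>
  The number \<open>n\<close> of vertices is the square root of the input length; \<open>n\<^sup>2\<close> is accumulated in register 3.
\<close>

definition sqrt_code :: program where
  "sqrt_code = [Const 1 1, Sub 4 0 3, Jump_zero 4 7, Add 3 3 2, Add 2 2 1, Add 3 3 2, Jump 1]"

text \<open>The invariant is maintained by \<open>Suc i * Suc i = i * i + i + Suc i\<close>, and the
  truncated difference vanishes exactly at \<open>i = n\<close>. Zero registers from 5 on mean that
  every variable starts at 0.\<close>

lemma sqrt_loop:
  assumes code: "code_at P 0 sqrt_code"
  shows "R 0 = n * n \<Longrightarrow> R 1 = 1 \<Longrightarrow> R 2 = i \<Longrightarrow> R 3 = i * i \<Longrightarrow> (\<forall>r\<ge>5. R r = 0) \<Longrightarrow> i \<le> n \<Longrightarrow>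
    \<exists>R'. runs P w (1, R) (6 * (n - i) + 2) (7, R') \<and> holds_env n (\<lambda>_. 0) R'"
proof (induction "n - i" arbitrary: i R)
  case 0
  let ?R = "R(4 := 0)"
  have "runs P w (1, R) (Suc (Suc 0)) (7, ?R)"
    using 0 code by (auto intro!: runs_step runs_eq simp: sqrt_code_def)
  then have "runs P w (1, R) (6 * (n - i) + 2) (7, ?R)"
    using 0 by (simp add: numeral_2_eq_2)
  moreover have "holds_env n (\<lambda>_. 0) ?R"
    using 0 unfolding holds_env_def by simp
  ultimately show ?case by blast
next
  case (Suc k)
  let ?R = "R(4 := n * n - i * i, 2 := Suc i, 3 := Suc i * Suc i)"
  have "i * i < n * n"
    using Suc.hyps(2) by (intro mult_strict_mono) auto
  then have run: "runs P w (1, R) (Suc (Suc (Suc (Suc (Suc (Suc 0)))))) (1, ?R)"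
    using Suc.prems code by (auto intro!: runs_step runs_eq simp: sqrt_code_def fun_eq_iff)
  have "k = n - Suc i" "Suc i \<le> n"
    using Suc.hyps(2) by simp_all
  with Suc.hyps(1)[of "Suc i" ?R] Suc.prems obtain R' where
    "runs P w (1, ?R) (6 * (n - Suc i) + 2) (7, R')" "holds_env n (\<lambda>_. 0) R'"
    by auto
  moreover have "6 * (n - i) + 2 = Suc (Suc (Suc (Suc (Suc (Suc 0))))) + (6 * (n - Suc i) + 2)"
    using Suc.hyps(2) by simp
  ultimately show ?case
    using runs_trans[OF run] by metis
qed

lemma poly_nat_mono: "a \<le> b \<Longrightarrow> poly p a \<le> poly p (b :: nat)"
  by (induction p) (auto intro: add_mono mult_mono)

text \<open>Polynomial data complexity of first-order logic: program and polynomial depend on the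
  formula alone.\<close>

lemma fo_decidable_in_poly_time:
  fixes f :: fo
  obtains P and q :: "nat poly" where
    "\<And>w n. length w = n * n \<Longrightarrow> answers_within P w (poly q (length w))
      (sat {..<n} (\<lambda>i j. i * n + j < length w \<and> w ! (i * n + j)) (\<lambda>_. 0) f)"
proof
  let ?P = "sqrt_code @ fo_code 7 0 f" and ?q = "[:3, 6:] + fo_time f"
  fix w :: "bool list" and n
  let ?b = "sat {..<n} (\<lambda>i j. i * n + j < length w \<and> w ! (i * n + j)) (\<lambda>_. 0) f"
  assume len: "length w = n * n"
  let ?R0 = "(\<lambda>_. 0)(0 := n * n, 1 := 1)"
  have "code_at ?P 0 ?P" "length sqrt_code = 7"
    by (simp_all add: code_at_def sqrt_code_def)
  then have code: "code_at ?P 0 sqrt_code" "code_at ?P 7 (fo_code 7 0 f)"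
    unfolding code_at_append by simp_all
  have "runs ?P w (init_config w) (Suc 0) (1, ?R0)"
    using len by (auto intro!: runs_step runs_eq simp: sqrt_code_def init_config_def)
  moreover obtain R1 where run1: "runs ?P w (1, ?R0) (6 * (n - 0) + 2) (7, R1)"
    and env: "holds_env n (\<lambda>_. 0) R1"
    using sqrt_loop[OF code(1), of ?R0 n 0 w] by auto
  moreover obtain R2 where "runs ?P w (7, R1) (poly (fo_time f) n) (7 + fo_size f, R2)"
    and R2: "R2 0 = of_bool ?b"
    using fo_code_correct[OF refl code(2) env] by blast
  ultimately have "runs ?P w (init_config w) (Suc 0 + (6 * (n - 0) + 2 + poly (fo_time f) n))
      (7 + fo_size f, R2)"
    using runs_trans by blast
  \<comment> \<open>The cost is a polynomial in \<open>n\<close> with natural coefficients, and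
    \<open>n \<le> n * n\<close>, so its value at the input length is a bound.\<close>
  moreover have "Suc 0 + (6 * (n - 0) + 2 + poly (fo_time f) n) \<le> poly ?q (length w)"
  proof -
    have "Suc 0 + (6 * (n - 0) + 2 + poly (fo_time f) n) = poly ?q n"
      by simp
    also have "\<dots> \<le> poly ?q (length w)"
      unfolding len by (intro poly_nat_mono) simp
    finally show ?thesis .
  qed
  ultimately have "runs ?P w (init_config w) (poly ?q (length w)) (7 + fo_size f, R2)"
    by (rule runs_mono)
  moreover have "length ?P \<le> 7 + fo_size f"
    by (simp add: sqrt_code_def)
  ultimately show "answers_within ?P w (poly ?q (length w)) ?b"
    unfolding answers_within_def using R2 runs_halt by blast
qed

section \<open>Adjacency matrices\<close>

lemma concat_rectangular:
  assumes "\<forall>xs \<in> set xss. length xs = n"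
  shows length_concat_rectangular: "length (concat xss) = length xss * n"
    and nth_concat_rectangular:
      "i < length xss \<Longrightarrow> j < n \<Longrightarrow> concat xss ! (i * n + j) = xss ! i ! j"
proof -
  show "length (concat xss) = length xss * n"
    using assms by (induction xss) auto
  show "i < length xss \<Longrightarrow> j < n \<Longrightarrow> concat xss ! (i * n + j) = xss ! i ! j"
    using assms
  proof (induction xss arbitrary: i)
    case (Cons xs xss)
    then show ?case by (cases i) (auto simp: nth_append)
  qed simp
qed

lemma length_adjacency_bits: "length (adjacency_bits G vs) = length vs * length vs"
  unfolding adjacency_bits_def by (subst length_concat_rectangular[of _ "length vs"]) auto

lemma nth_adjacency_bits:
  assumes "i < length vs" "j < length vs"
  shows "adjacency_bits G vs ! (i * length vs + j) \<longleftrightarrow> (vs ! i, vs ! j) \<in> parcs G"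
  unfolding adjacency_bits_def
  using assms by (subst nth_concat_rectangular[of _ "length vs"]) auto

text \<open>The machine computes with positions, which \<open>(!) vs\<close> identifies with
  vertices. As \<open>vs\<close> is nonempty, the initial value 0 is a position; it stands for
  \<open>hd vs\<close>.\<close>

lemma sat_adjacency_bits:
  assumes "distinct vs" "set vs = pverts G" "vs \<noteq> []"
  defines "n \<equiv> length vs" and "w \<equiv> adjacency_bits G vs"
  shows "sat {..<n} (\<lambda>i j. i * n + j < length w \<and> w ! (i * n + j)) (\<lambda>_. 0) f \<longleftrightarrow>
    sat (pverts G) (\<lambda>u v. (u, v) \<in> parcs G) (\<lambda>_. hd vs) f"
proof -
  let ?E = "\<lambda>i j. i * n + j < length w \<and> w ! (i * n + j)"
  have bij: "bij_betw ((!) vs) {..<n} (pverts G)"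
    using assms bij_betw_nth by blast
  have "((vs ! i, vs ! j) \<in> parcs G) = ?E i j" if ij: "i \<in> {..<n}" "j \<in> {..<n}" for i j
  proof -
    \<comment> \<open>The index stays inside the matrix, so the length test in \<open>?E\<close>
      succeeds.\<close>
    have "i * n + j < Suc i * n" "Suc i * n \<le> n * n"
      using ij by (auto intro: mult_le_mono1 simp del: mult_Suc simp: Suc_le_eq) simp
    then show ?thesis
      using nth_adjacency_bits[of i vs j G] length_adjacency_bits[of G vs] ij
      unfolding w_def n_def by auto
  qed
  then have "sat (pverts G) (\<lambda>u v. (u, v) \<in> parcs G) ((!) vs \<circ> (\<lambda>_. 0)) f =
      sat {..<n} ?E (\<lambda>_. 0) f"
    using \<open>vs \<noteq> []\<close> by (intro sat_bij_betw[OF bij]) (auto simp: n_def)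
  moreover have "(!) vs \<circ> (\<lambda>_. 0) = (\<lambda>_ :: nat. hd vs)"
    using \<open>vs \<noteq> []\<close> by (auto simp: hd_conv_nth)
  ultimately show ?thesis by simp
qed

section \<open>Deciding well-domination for a fixed domination number\<close>

lemma domination_number_empty:
  assumes "pverts G = {}"
  shows "domination_number G = 0"
proof -
  have "{card D | D. dominating_set G D} = {0}"
    using assms unfolding dominating_set_def by auto
  then show ?thesis unfolding domination_number_def by simp
qed

theorem theorem18:
  fixes k :: nat
  assumes "k \<ge> 1"
  shows "\<exists>P :: program.
    poly_time_decides P
      (\<lambda>(G, vs). adjacency_bits G vs)
      {(G :: nat pair_pre_digraph, vs). (G, vs) \<in> presented_graphs \<and> domination_number G = k}
      (\<lambda>(G, vs). well_dominated G)"
proof -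
  \<comment> \<open>The sentence depends on \<open>k\<close> only, so program and polynomial are
    chosen before the graph.\<close>
  obtain P q where P: "\<And>w n. length w = n * n \<Longrightarrow> answers_within P w (poly q (length w))
      (sat {..<n} (\<lambda>i j. i * n + j < length w \<and> w ! (i * n + j)) (\<lambda>_. 0)
        (Neg (private_sentence (Suc k))))"
    using fo_decidable_in_poly_time by blast
  have "answers_within P (adjacency_bits G vs) (poly q (length (adjacency_bits G vs))) (well_dominated G)"
    if "(G, vs) \<in> presented_graphs" and k: "domination_number G = k"
    for G :: "nat pair_pre_digraph" and vs
  proof -
    have vs: "distinct vs" "set vs = pverts G"
      using that unfolding presented_graphs_def by auto
    then have fin: "finite (pverts G)"
      by (metis finite_set)
    \<comment> \<open>A positive domination number excludes the graph without vertices, where the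
      variables would have no initial value.\<close>
    have "vs \<noteq> []"
      using vs(2) k assms domination_number_empty by fastforce
    then have "sat {..<length vs} (\<lambda>i j. i * length vs + j < length (adjacency_bits G vs) \<and>
        adjacency_bits G vs ! (i * length vs + j)) (\<lambda>_. 0) (Neg (private_sentence (Suc k))) \<longleftrightarrow>
        well_dominated G"
      using well_dominated_iff_no_private_system[OF fin] k
      by (simp only: sat_adjacency_bits[OF vs] sat.simps(3) sat_private_sentence not_False_eq_True)
    then show ?thesis
      using P[OF length_adjacency_bits, of G vs] by simp
  qed
  then show ?thesis
    unfolding poly_time_decides_def by (intro exI[of _ P] exI[of _ q]) auto
qed

end
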